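(* Let $n, m, k$ be integers with $n, k \ge 3$ and $m \ge 2$. Then the strong metric dimension of the layer Sun graph $LSG(n,m,k)$ is $nm^{k-2}-1$.
   Context: All graphs are finite, simple and connected. Layer Sun graph: for integers $n,k\ge 3$ and $m\ge 2$, the graph $LSG(n,m,k)$ has vertex set partitioned into layers $V_1\cup V_2\cup\dots\cup V_k$. The layer $V_1=\{1,2,\dots,n\}$ induces the cycle $C_n$. The layer $V_2=\{v_1,\dots,v_n\}$ has $n$ vertices, and each cycle vertex $i$ is adjacent to exactly one vertex of $V_2$, namely $v_i$. For $3\le l\le k$, the layer $V_l$ has $nm^{l-2}$ vertices and is partitioned into $nm^{l-3}$ sets (components) $B^{(l)}_{ij}$, $1\le i\le n$, $1\le j\le m^{l-3}$, each consisting of $m$ pairwise non-adjacent vertices. Each $v_i\in V_2$ is adjacent to all $m$ vertices of $B^{(3)}_{i1}$, and, for $3\le l\le k-1$ and each $i$, the $m^{l-2}$ vertices of $\bigcup_j B^{(l)}_{ij}$ are in bijection with the $m^{l-2}$ components $B^{(l+1)}_{i1},\dots,B^{(l+1)}_{i\,m^{l-2}}$ of $V_{l+1}$, each vertex being adjacent to all $m$ vertices of its corresponding component. There are no other edges. Equivalently, $LSG(n,m,k)$ is obtained from $C_n$ by attaching to each cycle vertex $i$, by an edge to its root $v_i$, a rooted tree in which the root has level $2$, every vertex of level $2,\dots,k-1$ has exactly $m$ children, and the vertices of level $k$ are leaves. The graph has order $2n+\sum_{r=1}^{k-2} nm^r$. Strong metric dimension: a vertex $w$ of a graph $G$ strongly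 resolves two vertices $u$ and $v$ if $u$ belongs to a shortest $v$–$w$ path or $v$ belongs to a shortest $u$–$w$ path. A set $S$ of vertices of $G$ is a strong resolving set of $G$ if every two distinct vertices of $G$ are strongly resolved by some vertex of $S$. The strong metric dimension $sdim(G)$ is the minimum cardinality of a strong resolving set of $G$. *)

theory Defs
  imports "Graph_Theory.Graph_Theory"
begin

text \<open>Simple graphs are rendered as symmetric loop-free digraphs without parallel arcs
  (locale \<^locale>\<open>pair_graph\<close>); paths are duplicate-free vertex lists.\<close>

definition shortest_vpath :: "('a, 'b) pre_digraph \<Rightarrow> 'a \<Rightarrow> 'a list \<Rightarrow> 'a \<Rightarrow> bool" where
  "shortest_vpath G u p v \<longleftrightarrow>
     vpath p G \<and> hd p = u \<and> last p = v \<and>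
     (\<forall>q. vpath q G \<and> hd q = u \<and> last q = v \<longrightarrow> vwalk_length p \<le> vwalk_length q)"

definition strongly_resolves :: "('a, 'b) pre_digraph \<Rightarrow> 'a \<Rightarrow> 'a \<Rightarrow> 'a \<Rightarrow> bool" where
  "strongly_resolves G w u v \<longleftrightarrow>
     (\<exists>p. shortest_vpath G v p w \<and> u \<in> set p) \<or>
     (\<exists>p. shortest_vpath G u p w \<and> v \<in> set p)"

definition strong_resolving_set :: "('a, 'b) pre_digraph \<Rightarrow> 'a set \<Rightarrow> bool" where
  "strong_resolving_set G S \<longleftrightarrow>
     S \<subseteq> verts G \<and>
     (\<forall>u\<in>verts G. \<forall>v\<in>verts G. u \<noteq> v \<longrightarrow> (\<exists>w\<in>S. strongly_resolves G w u v))"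

definition sdim :: "('a, 'b) pre_digraph \<Rightarrow> nat" where
  "sdim G = (LEAST c. \<exists>S. finite S \<and> strong_resolving_set G S \<and> card S = c)"

text \<open>A vertex of the layer Sun graph is a triple \<open>(l, i, t)\<close>: \<open>l\<close> is the layer (counted from 1),
  \<open>i < n\<close> the cycle vertex to which it belongs, and \<open>t\<close> its position among the vertices of layer
  \<open>l\<close> belonging to \<open>i\<close>. The indices \<open>i\<close>, \<open>t\<close>, and the component index \<open>j\<close> are counted from 0.\<close>

type_synonym lsg_vertex = "nat \<times> nat \<times> nat"

definition LSG_layer :: "nat \<Rightarrow> nat \<Rightarrow> nat \<Rightarrow> lsg_vertex set" where
  "LSG_layer n m l = {(l, i, t) | i t. i < n \<and> t < (if l = 1 then 1 else m ^ (l - 2))}"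

text \<open>The component \<open>B\<^sup>(\<^sup>l\<^sup>)\<^sub>i\<^sub>j\<close>, for \<open>l \<ge> 3\<close> and \<open>j < m ^ (l - 3)\<close>.\<close>

definition LSG_component :: "nat \<Rightarrow> nat \<Rightarrow> nat \<Rightarrow> nat \<Rightarrow> lsg_vertex set" where
  "LSG_component m l i j = {(l, i, j * m + s) | s. s < m}"

text \<open>The bijection between the vertices of layer \<open>l\<close> and the components of layer \<open>l + 1\<close> is
  chosen to be \<open>(l, i, t) \<mapsto> B\<^sup>(\<^sup>l\<^sup>+\<^sup>1\<^sup>)\<^sub>i\<^sub>t\<close>; any other choice gives an isomorphic graph. In
  \<open>LSG_edges\<close> each edge is listed in one orientation only.\<close>

definition LSG_edges :: "nat \<Rightarrow> nat \<Rightarrow> nat \<Rightarrow> lsg_vertex rel" where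
  "LSG_edges n m k =
     {((1, i, 0), (1, (i + 1) mod n, 0)) | i. i < n} \<union>
     {((1, i, 0), (2, i, 0)) | i. i < n} \<union>
     {((l, i, t), v) | l i t v. 2 \<le> l \<and> l \<le> k - 1 \<and> i < n \<and> t < m ^ (l - 2) \<and>
                                v \<in> LSG_component m (l + 1) i t}"

definition LSG :: "nat \<Rightarrow> nat \<Rightarrow> nat \<Rightarrow> lsg_vertex pair_pre_digraph" where
  "LSG n m k =
     \<lparr> pverts = (\<Union>l\<in>{1..k}. LSG_layer n m l),
       parcs = LSG_edges n m k \<union> (LSG_edges n m k)\<inverse> \<rparr>"

lemma card_LSG_layer: "card (LSG_layer n m l) = n * (if l = 1 then 1 else m ^ (l - 2))"
proof -
  have "LSG_layer n m l = {l} \<times> {..<n} \<times> {..<(if l = 1 then 1 else m ^ (l - 2))}"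
    by (auto simp: LSG_layer_def)
  then show ?thesis by (simp add: card_cartesian_product)
qed

lemma finite_LSG_layer: "finite (LSG_layer n m l)"
proof -
  have "LSG_layer n m l = {l} \<times> {..<n} \<times> {..<(if l = 1 then 1 else m ^ (l - 2))}"
    by (auto simp: LSG_layer_def)
  then show ?thesis by simp
qed

lemma LSG_layer_eq_UN_component:
  assumes "3 \<le> l" "2 \<le> m"
  shows "LSG_layer n m l = (\<Union>i<n. \<Union>j<m ^ (l - 3). LSG_component m l i j)"
proof -
  have l: "l - 2 = Suc (l - 3)" using assms by simp
  have lt: "j * m + s < m ^ (l - 2)" if "j < m ^ (l - 3)" "s < m" for j s
  proof -
    have "j * m + s < Suc j * m" using that by simp
    also have "\<dots> \<le> m ^ (l - 3) * m" using that by (intro mult_right_mono) auto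
    finally show ?thesis by (simp add: l mult.commute)
  qed
  show ?thesis
  proof (intro equalityI subsetI)
    fix x assume "x \<in> LSG_layer n m l"
    then obtain i t where x: "x = (l, i, t)" "i < n" "t < m ^ (l - 2)"
      using assms by (auto simp: LSG_layer_def)
    have "t div m < m ^ (l - 3)"
      using x(3) by (simp add: l less_mult_imp_div_less mult.commute)
    moreover have "x \<in> LSG_component m l i (t div m)"
      using x assms by (auto simp: LSG_component_def intro!: exI[of _ "t mod m"])
    ultimately show "x \<in> (\<Union>i<n. \<Union>j<m ^ (l - 3). LSG_component m l i j)"
      using x by blast
  next
    fix x assume "x \<in> (\<Union>i<n. \<Union>j<m ^ (l - 3). LSG_component m l i j)"
    then show "x \<in> LSG_layer n m l"
      using assms lt by (auto simp: LSG_layer_def LSG_component_def)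
  qed
qed

lemma card_LSG:
  assumes "3 \<le> k"
  shows "card (pverts (LSG n m k)) = 2 * n + (\<Sum>r = 1..k - 2. n * m ^ r)"
proof -
  have "card (pverts (LSG n m k)) = (\<Sum>l = 1..k. card (LSG_layer n m l))"
    unfolding LSG_def pair_pre_digraph.simps
    by (rule card_UN_disjoint) (auto simp: finite_LSG_layer, auto simp: LSG_layer_def)
  also have "\<dots> = 2 * n + (\<Sum>r = 1..k - 2. n * m ^ r)"
  proof -
    have "(\<Sum>l = 1..r + 2. card (LSG_layer n m l)) = 2 * n + (\<Sum>r = 1..r. n * m ^ r)" for r
      by (induction r) (simp_all add: card_LSG_layer numeral_2_eq_2)
    moreover have "k - 2 + 2 = k" using assms by simp
    ultimately show ?thesis by metis
  qed
  finally show ?thesis .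
qed

lemma LSG_edges_wf:
  assumes "3 \<le> n" "2 \<le> m" "3 \<le> k" "(x, y) \<in> LSG_edges n m k"
  shows "x \<in> pverts (LSG n m k)" "y \<in> pverts (LSG n m k)" "x \<noteq> y"
proof -
  consider (c) i where "i < n" "x = (1, i, 0)" "y = (1, (i + 1) mod n, 0)"
    | (p) i where "i < n" "x = (1, i, 0)" "y = (2, i, 0)"
    | (t) l i t where "2 \<le> l" "l \<le> k - 1" "i < n" "t < m ^ (l - 2)" "x = (l, i, t)"
        "y \<in> LSG_component m (l + 1) i t"
    using assms(4) unfolding LSG_edges_def by blast
  then have "x \<in> pverts (LSG n m k) \<and> y \<in> pverts (LSG n m k) \<and> x \<noteq> y"
  proof cases
    case c
    have "(i + 1) mod n \<noteq> i"
      using \<open>i < n\<close> assms by (cases "i + 1 = n") auto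
    with c assms show ?thesis by (auto simp: LSG_def LSG_layer_def)
  next
    case p
    with assms show ?thesis by (auto simp: LSG_def LSG_layer_def intro!: bexI[of _ 1] bexI[of _ 2])
  next
    case t
    then have "y \<in> LSG_layer n m (l + 1)"
      using assms by (subst LSG_layer_eq_UN_component) auto
    moreover have "x \<in> LSG_layer n m l" using t by (auto simp: LSG_layer_def)
    moreover have "x \<noteq> y" using t by (auto simp: LSG_component_def)
    ultimately show ?thesis using t assms by (auto simp: LSG_def)
  qed
  then show "x \<in> pverts (LSG n m k)" "y \<in> pverts (LSG n m k)" "x \<noteq> y" by auto
qed

lemma pair_graph_LSG:
  assumes "3 \<le> n" "2 \<le> m" "3 \<le> k"
  shows "pair_graph (LSG n m k)"
proof -
  have wf: "fst e \<in> pverts (LSG n m k) \<and> snd e \<in> pverts (LSG n m k) \<and> fst e \<noteq> snd e"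
    if "e \<in> parcs (LSG n m k)" for e
    using that LSG_edges_wf[OF assms, of "fst e" "snd e"] LSG_edges_wf[OF assms, of "snd e" "fst e"]
    by (auto simp: LSG_def)
  have fin: "finite (pverts (LSG n m k))"
    by (simp add: LSG_def finite_LSG_layer)
  have "parcs (LSG n m k) \<subseteq> pverts (LSG n m k) \<times> pverts (LSG n m k)"
    using wf by (auto simp: mem_Times_iff)
  then have fina: "finite (parcs (LSG n m k))"
    by (rule finite_subset) (simp add: fin)
  have "symmetric (with_proj (LSG n m k))"
    by (auto simp: symmetric_def sym_def LSG_def)
  with wf fin fina show ?thesis by unfold_locales auto
qed

end

theory Submission
  imports Defs
begin

text \<open>
  The graph is a cycle with a rooted tree hanging at each of its vertices. Both bounds come from the
  \<open>n * m ^ (k - 2)\<close> leaves in layer \<open>k\<close>.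

  Lower bound (\<open>card_pendant_le_strong_resolving_set\<close>): a leaf has a single neighbour, so
  it is never an inner vertex of a path. Hence two leaves are strongly resolved only by one of
  themselves, and a strong resolving set misses at most one leaf.

  Upper bound: all leaves but one, \<open>x\<^sub>0\<close>, form a strong resolving set. Let the branch of a vertex
  \<open>v\<close> consist of \<open>v\<close> and everything hanging below it; for a vertex of the cycle, this includes the
  whole tree attached there. An edge between the branch of \<open>v\<close> and its complement always has \<open>v\<close> as
  its end in the branch (\<open>LSG_arc_enters_branch\<close>). So every path, in particular a shortest
  one, from outside the branch to a leaf inside passes through \<open>v\<close>, and the leaf strongly
  resolves \<open>v\<close> from every vertex outside its branch (\<open>gate_strongly_resolves\<close>). Two distinct
  vertices cannot each lie in the branch of the other, so at least one of them can be taken as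
  \<open>v\<close>. Every vertex except \<open>x\<^sub>0\<close> has a leaf other than \<open>x\<^sub>0\<close> in its branch, because
  every inner vertex of a tree has at least two children. What remains is the pair of \<open>x\<^sub>0\<close> and an
  ancestor \<open>u\<close> of it, where the argument is reversed: a path from \<open>x\<^sub>0\<close> to a leaf hanging at another
  vertex of the cycle leaves the branch of \<open>u\<close>, and must do so through \<open>u\<close>.
\<close>

section \<open>Strong resolution in graphs\<close>

lemma strongly_resolves_commute: "strongly_resolves G w u v \<longleftrightarrow> strongly_resolves G w v u"
  unfolding strongly_resolves_def by blast

lemma (in wf_digraph) shortest_vpath_exists:
  assumes "u \<rightarrow>\<^sup>* v"
  obtains p where "shortest_vpath G u p v"
proof -
  let ?P = "\<lambda>p. vpath p G \<and> hd p = u \<and> last p = v"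
  obtain q where "?P q"
    using assms unfolding reachable_vpath_conv by blast
  then obtain p where "?P p" "\<forall>q. ?P q \<longrightarrow> vwalk_length p \<le> vwalk_length q"
    using ex_has_least_nat[of ?P q vwalk_length] by blast
  then have "shortest_vpath G u p v"
    unfolding shortest_vpath_def by blast
  then show thesis by (rule that)
qed

lemma vwalk_meets_gate:
  assumes "vwalk p G" "hd p \<notin> D" "last p \<in> D"
    and "\<And>a b. (a, b) \<in> arcs_ends G \<Longrightarrow> a \<notin> D \<Longrightarrow> b \<in> D \<Longrightarrow> a = v \<or> b = v"
  shows "v \<in> set p"
  using assms(1-3)
proof (induction rule: vwalk_induct)
  case (Base u)
  then show ?case by simp
next
  case (Cons u x es)
  then show ?case using assms(4)[of u x] by (cases "x \<in> D") auto
qed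

text \<open>The hypothesis only asks that \<open>v\<close> be one of the two ends of each arc entering \<open>D\<close>, so that in
  a symmetric graph the lemma applies to a set and to its complement alike.\<close>

lemma (in wf_digraph) gate_strongly_resolves:
  assumes "u \<rightarrow>\<^sup>* w" "u \<notin> D" "w \<in> D"
    and "\<And>a b. (a, b) \<in> arcs_ends G \<Longrightarrow> a \<notin> D \<Longrightarrow> b \<in> D \<Longrightarrow> a = v \<or> b = v"
  shows "strongly_resolves G w u v"
proof -
  obtain p where p: "shortest_vpath G u p w"
    using assms(1) by (rule shortest_vpath_exists)
  then have "vwalk p G" "hd p \<notin> D" "last p \<in> D"
    using assms(2,3) by (auto simp: shortest_vpath_def vpath_def)
  then have "v \<in> set p"
    using assms(4) by (rule vwalk_meets_gate)
  with p show ?thesis unfolding strongly_resolves_def by blast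
qed

text \<open>An inner vertex of a path has two neighbours on it, and these are distinct.\<close>

lemma pendant_end_of_vpath:
  assumes "vpath q G" "u \<in> set q"
    and "\<And>a. (a, u) \<in> arcs_ends G \<Longrightarrow> a = c" "\<And>a. (u, a) \<in> arcs_ends G \<Longrightarrow> a = c"
  shows "u = hd q \<or> u = last q"
proof (rule ccontr)
  assume *: "\<not> ?thesis"
  obtain xs ys where q: "q = xs @ u # ys"
    using assms(2) by (meson split_list)
  with * have ne: "xs \<noteq> []" "ys \<noteq> []" by auto
  have "set (vwalk_arcs q) \<subseteq> arcs_ends G"
    using assms(1) by (auto simp: vpath_def vwalk_def)
  then have "(last xs, u) \<in> arcs_ends G" "(u, hd ys) \<in> arcs_ends G"
    using ne by (auto simp: q vwalk_arcs_append)
  then have "last xs = hd ys"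
    using assms(3,4) by metis
  moreover have "distinct q" using assms(1) by (simp add: vpath_def)
  ultimately show False
    using ne by (auto simp: q) (metis disjoint_iff hd_in_set last_in_set)
qed

text \<open>Two vertices of \<open>L\<close> outside \<open>S\<close> could not be resolved: on the shortest path witnessing it,
  one of them would have to lie strictly between the other and the resolving vertex.\<close>

lemma card_pendant_le_strong_resolving_set:
  assumes "finite S" "strong_resolving_set G S" "L \<subseteq> verts G"
    and in_nb: "\<And>u a. u \<in> L \<Longrightarrow> (a, u) \<in> arcs_ends G \<Longrightarrow> a = c u"
    and out_nb: "\<And>u a. u \<in> L \<Longrightarrow> (u, a) \<in> arcs_ends G \<Longrightarrow> a = c u"
  shows "card L - 1 \<le> card S"
proof -
  have "u = v" if uv: "u \<in> L - S" "v \<in> L - S" for u v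
  proof (rule ccontr)
    assume "u \<noteq> v"
    then obtain w where w: "w \<in> S" "strongly_resolves G w u v"
      using assms(2,3) uv unfolding strong_resolving_set_def by blast
    have no_path: False
      if "x \<in> L - S" "x \<noteq> y" "shortest_vpath G y p w" "x \<in> set p" for x y p
    proof -
      have "x = hd p \<or> x = last p"
        using that in_nb[of x] out_nb[of x]
        by (intro pendant_end_of_vpath[of p G x "c x"]) (auto simp: shortest_vpath_def)
      then show False using that w(1) by (auto simp: shortest_vpath_def)
    qed
    show False
      using w(2) no_path uv \<open>u \<noteq> v\<close> unfolding strongly_resolves_def by metis
  qed
  then have "card (L - S) \<le> 1"
    by (metis (no_types, lifting) card.infinite card_le_Suc0_iff_eq One_nat_def zero_le)
  moreover have "card L - card S \<le> card (L - S)"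
    using assms(1) by (rule diff_card_le_card_Diff)
  ultimately show ?thesis by linarith
qed

section \<open>Edges and connectedness of the layer Sun graph\<close>

lemma mem_verts_LSG:
  "(l, i, t) \<in> pverts (LSG n m k) \<longleftrightarrow>
     1 \<le> l \<and> l \<le> k \<and> i < n \<and> t < (if l = 1 then 1 else m ^ (l - 2))"
  by (auto simp: LSG_def LSG_layer_def)

lemma LSG_layer_subset_verts: "1 \<le> l \<Longrightarrow> l \<le> k \<Longrightarrow> LSG_layer n m l \<subseteq> pverts (LSG n m k)"
  unfolding LSG_def by auto

text \<open>The edge from a cycle vertex to the root of its tree follows the same numbering rule as
  the edges inside the tree, so that two kinds of edges remain.\<close>

lemma LSG_edges_cases [consumes 2, case_names cycle child]:
  assumes "0 < m" "(a, b) \<in> LSG_edges n m k"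
  obtains i j where "a = (1, i, 0)" "b = (1, j, 0)"
  | l i t s where "a = (l, i, t)" "b = (Suc l, i, t * m + s)" "1 \<le> l" "l < k \<or> l = 1" "s < m"
proof -
  consider (c) i where "a = (1, i, 0)" "b = (1, (i + 1) mod n, 0)"
    | (r) i where "a = (1, i, 0)" "b = (2, i, 0)"
    | (t) l i t where "2 \<le> l" "l \<le> k - 1" "a = (l, i, t)" "b \<in> LSG_component m (l + 1) i t"
    using assms(2) unfolding LSG_edges_def by blast
  then show thesis
  proof cases
    case c
    then show thesis by (rule that(1))
  next
    case r
    then show thesis using that(2)[of 1 i 0 0] assms(1) by (simp add: numeral_2_eq_2)
  next
    case t
    then show thesis using that(2)[of l i t] by (auto simp: LSG_component_def)
  qed
qed

lemma parent_edge_LSG: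
  assumes "0 < m" "1 \<le> l" "(Suc l, i, t) \<in> pverts (LSG n m k)"
  shows "((l, i, t div m), (Suc l, i, t)) \<in> LSG_edges n m k"
proof (cases "l = 1")
  case True
  then show ?thesis
    using assms by (auto simp: mem_verts_LSG LSG_edges_def numeral_2_eq_2)
next
  case False
  then have l: "Suc l - 2 = Suc (l - 2)" "2 \<le> l" using assms(2) by auto
  then have "t div m < m ^ (l - 2)"
    using assms by (simp add: mem_verts_LSG less_mult_imp_div_less mult.commute)
  moreover have "(Suc l, i, t) \<in> LSG_component m (l + 1) i (t div m)"
    using assms(1) by (auto simp: LSG_component_def intro!: exI[of _ "t mod m"])
  moreover have "l \<le> k - 1" "i < n" using assms by (auto simp: mem_verts_LSG)
  ultimately show ?thesis using l(2) unfolding LSG_edges_def by blast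
qed

lemma LSG_connected:
  assumes "3 \<le> n" "2 \<le> m" "3 \<le> k" "u \<in> pverts (LSG n m k)" "v \<in> pverts (LSG n m k)"
  shows "u \<rightarrow>\<^sup>*\<^bsub>with_proj (LSG n m k)\<^esub> v"
proof -
  interpret pair_graph "LSG n m k" using assms(1-3) by (rule pair_graph_LSG)
  let ?R = "\<lambda>v. (1, 0, 0) \<rightarrow>\<^sup>*\<^bsub>with_proj (LSG n m k)\<^esub> v"
  have step: "?R y" if "?R x" "(x, y) \<in> LSG_edges n m k" for x y
  proof -
    have "(x, y) \<in> parcs (LSG n m k)" using that(2) by (simp add: LSG_def)
    with that(1) show ?thesis using reachable_adj_trans by simp
  qed
  have cyc: "?R (1, i, 0)" if "i < n" for i
    using that
  proof (induction i)
    case 0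
    then show ?case using assms by (auto simp: mem_verts_LSG)
  next
    case (Suc i)
    then have "((1, i, 0), (1, Suc i, 0)) \<in> LSG_edges n m k"
      unfolding LSG_edges_def by (auto intro!: exI[of _ i])
    with Suc show ?case using step by simp
  qed
  have reach: "?R (Suc l, i, t)" if "(Suc l, i, t) \<in> pverts (LSG n m k)" for l i t
    using that
  proof (induction l arbitrary: t)
    case 0
    then show ?case using cyc by (simp add: mem_verts_LSG)
  next
    case (Suc l)
    have e: "((Suc l, i, t div m), (Suc (Suc l), i, t)) \<in> LSG_edges n m k"
      using Suc.prems assms by (intro parent_edge_LSG) auto
    then have "(Suc l, i, t div m) \<in> pverts (LSG n m k)"
      using LSG_edges_wf(1) assms(1-3) by blast
    with Suc.IH e step show ?case by blast
  qed
  have "?R x" if "x \<in> pverts (LSG n m k)" for x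
  proof -
    obtain l i t where x: "x = (l, i, t)" by (cases x)
    with that have "l = Suc (l - 1)" by (auto simp: mem_verts_LSG)
    with reach that x show ?thesis by metis
  qed
  then show ?thesis
    using assms symmetric_reachable' reachable_trans by blast
qed

lemma LSG_leaf_neighbour:
  assumes "3 \<le> k" "0 < m" "(a, (k, i, t)) \<in> parcs (LSG n m k)"
  shows "a = (k - 1, i, t div m)"
proof -
  from assms(3) consider "(a, (k, i, t)) \<in> LSG_edges n m k" | "((k, i, t), a) \<in> LSG_edges n m k"
    by (auto simp: LSG_def)
  then show ?thesis
  proof cases
    case 1
    with assms(2) show ?thesis
      by (cases rule: LSG_edges_cases) (use assms(1) in auto)
  next
    case 2
    with assms(2) show ?thesis
      by (cases rule: LSG_edges_cases) (use assms(1) in auto)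
  qed
qed

section \<open>Branches\<close>

text \<open>The parent of position \<open>t\<close> is position \<open>t div m\<close> one layer up, so the \<open>j\<close>-th ancestor is at
  position \<open>t div m ^ j\<close>. This covers the cycle as well: the tree hanging at a cycle vertex has fewer
  than \<open>m ^ (l' - 1)\<close> vertices in layer \<open>l'\<close>, so the quotient is then \<open>0\<close>.\<close>

fun LSG_branch :: "nat \<Rightarrow> lsg_vertex \<Rightarrow> lsg_vertex set" where
  "LSG_branch m (l, i, t) = {(l', i, t') | l' t'. l \<le> l' \<and> t' div m ^ (l' - l) = t}"

lemma LSG_branch_self: "v \<in> LSG_branch m v"
  by (cases v) simp

lemma LSG_branch_antisym: "u \<in> LSG_branch m v \<Longrightarrow> v \<in> LSG_branch m u \<Longrightarrow> u = v"
  by (cases u; cases v) auto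

lemma LSG_branch_child:
  assumes "s < m"
  shows "(Suc l', i', t' * m + s) \<in> LSG_branch m v \<longleftrightarrow>
           v = (Suc l', i', t' * m + s) \<or> (l', i', t') \<in> LSG_branch m v"
proof -
  obtain l i t where v: "v = (l, i, t)" by (cases v)
  have div: "(t' * m + s) div m ^ (Suc l' - l) = t' div m ^ (l' - l)" if "l \<le> l'"
    using that assms by (simp add: Suc_diff_le div_mult2_eq)
  consider "l \<le> l'" | "l = Suc l'" | "Suc l' < l" by linarith
  then show ?thesis by cases (auto simp: v div)
qed

lemma LSG_arc_enters_branch:
  assumes "0 < m" "v \<in> pverts (LSG n m k)" "(a, b) \<in> parcs (LSG n m k)"
    and "a \<notin> LSG_branch m v" "b \<in> LSG_branch m v"
  shows "b = v"
proof -
  have cyc: "x = v" if "x = (1, i, 0)" "x \<in> LSG_branch m v" for x i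
    using that assms(2) by (cases v) (auto simp: mem_verts_LSG)
  from assms(3) consider "(a, b) \<in> LSG_edges n m k" | "(b, a) \<in> LSG_edges n m k"
    by (auto simp: LSG_def)
  then show ?thesis
  proof cases
    case 1
    with assms(1) show ?thesis
      by (cases rule: LSG_edges_cases) (use assms(4,5) cyc LSG_branch_child in auto)
  next
    case 2
    with assms(1) show ?thesis
      by (cases rule: LSG_edges_cases) (use assms(4,5) cyc LSG_branch_child in auto)
  qed
qed

text \<open>Above the last layer, the leaves in the branch of \<open>(l, i, t)\<close> occupy at least two consecutive
  positions, the first being \<open>t * m ^ (k - l)\<close>; the second is never position \<open>0\<close>. For a vertex
  of the cycle, whose branch has \<open>m ^ (k - 2)\<close> leaves, this uses \<open>k \<ge> 3\<close>.\<close>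

lemma LSG_branch_other_leaf:
  assumes "2 \<le> m" "3 \<le> k" "v \<in> pverts (LSG n m k)" "v \<noteq> (k, 0, 0)"
  obtains w where "w \<in> LSG_layer n m k - {(k, 0, 0)}" "w \<in> LSG_branch m v"
proof -
  obtain l i t where v: "v = (l, i, t)" by (cases v)
  have b: "1 \<le> l" "l \<le> k" "i < n" "t < (if l = 1 then 1 else m ^ (l - 2))"
    using assms(3) by (auto simp: v mem_verts_LSG)
  show thesis
  proof (cases "l = k")
    case True
    then have "v \<in> LSG_layer n m k" using b by (auto simp: v LSG_layer_def)
    then show thesis using that[of v] LSG_branch_self assms(4) by blast
  next
    case False
    have gt: "1 < m ^ j" if "0 < j" for j using that assms(1) one_less_power[of m j] by simp
    have q: "t * m ^ (k - l) + 1 < m ^ (k - 2)"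
    proof (cases "l = 1")
      case True
      then show ?thesis using b gt[of "k - 2"] assms(2) by simp
    next
      case False
      have "t * m ^ (k - l) + 1 < Suc t * m ^ (k - l)"
        using gt[of "k - l"] b(2) \<open>l \<noteq> k\<close> by simp
      also have "\<dots> \<le> m ^ (l - 2) * m ^ (k - l)"
        using b(4) False by (intro mult_right_mono) auto
      also have "\<dots> = m ^ (k - 2)"
        using b(1,2) False by (simp flip: power_add)
      finally show ?thesis .
    qed
    have "(t * m ^ (k - l) + 1) div m ^ (k - l) = t"
      using gt[of "k - l"] b(2) False by (intro div_nat_eqI) auto
    then have "(k, i, t * m ^ (k - l) + 1) \<in> LSG_branch m v"
      using b(2) by (simp add: v)
    moreover have "(k, i, t * m ^ (k - l) + 1) \<in> LSG_layer n m k - {(k, 0, 0)}"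
      using q b(3) assms(2) by (auto simp: LSG_layer_def)
    ultimately show thesis using that by blast
  qed
qed

section \<open>The strong metric dimension\<close>

lemma LSG_leaves_strong_resolving:
  assumes "3 \<le> n" "3 \<le> k" "2 \<le> m"
  shows "strong_resolving_set (with_proj (LSG n m k)) (LSG_layer n m k - {(k, 0, 0)})"
    (is "strong_resolving_set ?G ?S")
proof -
  interpret pair_graph "LSG n m k" using assms by (intro pair_graph_LSG)
  have sub: "?S \<subseteq> pverts (LSG n m k)" using assms LSG_layer_subset_verts[of k k] by auto
  have conn: "x \<rightarrow>\<^sup>*\<^bsub>?G\<^esub> y" if "x \<in> pverts (LSG n m k)" "y \<in> pverts (LSG n m k)" for x y
    using that assms by (intro LSG_connected)
  have outside: "\<exists>w\<in>?S. strongly_resolves ?G w x y"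
    if xy: "x \<in> pverts (LSG n m k)" "y \<in> pverts (LSG n m k)" "x \<notin> LSG_branch m y" "y \<noteq> (k, 0, 0)"
    for x y
  proof -
    obtain w where w: "w \<in> ?S" "w \<in> LSG_branch m y"
      using assms xy by (metis LSG_branch_other_leaf)
    have "strongly_resolves ?G w x y"
    proof (rule gate_strongly_resolves[where D = "LSG_branch m y"])
      show "x \<rightarrow>\<^sup>*\<^bsub>?G\<^esub> w" using conn xy w(1) sub by blast
      show "a = y \<or> b = y"
        if "(a, b) \<in> parcs (LSG n m k)" "a \<notin> LSG_branch m y" "b \<in> LSG_branch m y" for a b
        using that LSG_arc_enters_branch[of m y n k a b] xy assms by simp
    qed (use xy w in auto)
    with w show ?thesis by blast
  qed
  \<comment> \<open>The only leaf in the branch of \<open>(k, 0, 0)\<close> is that vertex itself, so a leaf at another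
    vertex of the cycle is used, and the gate lemma is applied to the complement of the branch.\<close>
  have above: "\<exists>w\<in>?S. strongly_resolves ?G w (k, 0, 0) u"
    if u: "u \<in> pverts (LSG n m k)" "(k, 0, 0) \<in> LSG_branch m u" for u
  proof -
    have w: "(k, 1, 0) \<in> ?S" using assms by (auto simp: LSG_layer_def)
    have "strongly_resolves ?G (k, 1, 0) (k, 0, 0) u"
    proof (rule gate_strongly_resolves[where D = "- LSG_branch m u"])
      show "(k, 0, 0) \<rightarrow>\<^sup>*\<^bsub>?G\<^esub> (k, 1, 0)"
        using assms by (intro conn) (auto simp: mem_verts_LSG)
      show "(k, 0, 0) \<notin> - LSG_branch m u" using u by simp
      show "(k, 1, 0) \<in> - LSG_branch m u" using u(2) by (cases u) auto
      show "a = u \<or> b = u"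
        if "(a, b) \<in> parcs (LSG n m k)" "a \<notin> - LSG_branch m u" "b \<in> - LSG_branch m u" for a b
        using that LSG_arc_enters_branch[of m u n k b a] u assms by (auto simp: LSG_def)
    qed
    with w show ?thesis by blast
  qed
  have "\<exists>w\<in>?S. strongly_resolves ?G w u v"
    if uv: "u \<in> pverts (LSG n m k)" "v \<in> pverts (LSG n m k)" "u \<noteq> v" for u v
  proof -
    have one: ?thesis if "u \<notin> LSG_branch m v" "v \<noteq> (k, 0, 0)"
      using outside uv that by blast
    have two: ?thesis if "v \<notin> LSG_branch m u" "u \<noteq> (k, 0, 0)"
      using outside[of v u] uv that strongly_resolves_commute by metis
    have three: ?thesis if "u \<in> LSG_branch m v" "u = (k, 0, 0)"
      using above[of v] uv that by simp
    have four: ?thesis if "v \<in> LSG_branch m u" "v = (k, 0, 0)"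
      using above[of u] uv that strongly_resolves_commute by metis
    show ?thesis
      using one two three four LSG_branch_antisym[of u m v] uv(3) by blast
  qed
  with sub show ?thesis unfolding strong_resolving_set_def by simp
qed

theorem theorem3p3:
  fixes n m k :: nat
  assumes "n \<ge> 3" and "k \<ge> 3" and "m \<ge> 2"
  shows "sdim (with_proj (LSG n m k)) = n * m ^ (k - 2) - 1"
proof -
  let ?G = "with_proj (LSG n m k)" and ?L = "LSG_layer n m k"
  have card_L: "card ?L = n * m ^ (k - 2)"
    using assms(2) by (simp add: card_LSG_layer)
  have lower: "n * m ^ (k - 2) - 1 \<le> card S"
    if S: "finite S" "strong_resolving_set ?G S" for S
  proof -
    have nb: "a = (\<lambda>(l, i, t). (k - 1, i, t div m)) u"
      if "u \<in> ?L" "(a, u) \<in> parcs (LSG n m k)" for u a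
      using that LSG_leaf_neighbour[of k m a] assms by (auto simp: LSG_layer_def)
    have "card ?L - 1 \<le> card S"
    proof (rule card_pendant_le_strong_resolving_set[OF S])
      show "?L \<subseteq> verts ?G" using assms LSG_layer_subset_verts[of k k] by simp
      show "a = (\<lambda>(l, i, t). (k - 1, i, t div m)) u"
        if "u \<in> ?L" "(a, u) \<in> arcs_ends ?G" for u a
        using nb that by simp
      show "a = (\<lambda>(l, i, t). (k - 1, i, t div m)) u"
        if "u \<in> ?L" "(u, a) \<in> arcs_ends ?G" for u a
        using nb[of u a] that by (auto simp: LSG_def)
    qed
    then show ?thesis by (simp add: card_L)
  qed
  have "(k, 0, 0) \<in> ?L" using assms by (auto simp: LSG_layer_def)
  then have card_S: "card (?L - {(k, 0, 0)}) = n * m ^ (k - 2) - 1"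
    by (simp add: card_L finite_LSG_layer)
  show ?thesis
    unfolding sdim_def
  proof (rule Least_equality)
    show "\<exists>S. finite S \<and> strong_resolving_set ?G S \<and> card S = n * m ^ (k - 2) - 1"
      using LSG_leaves_strong_resolving[OF assms] card_S finite_LSG_layer finite_Diff by blast
  qed (use lower in blast)
qed

end
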